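(* Let $\gamma>0$, let $n$ be a positive integer, let $a_1,\dots,a_n\in\mathbb{C}$, and let $T_n$ be the finite-rank operator on $\mathcal{H}_\gamma(\mathbb{D})$ given by $T_n(f)=\sum_{i=1}^{n}\langle f,a_iz^i\rangle a_iz^i$ for $f\in\mathcal{H}_\gamma(\mathbb{D})$. Then the Berezin range $\mathrm{Ber}(T_n)$ is convex in $\mathbb{C}$.
   Context: $\mathbb{D}$ is the open unit disc in $\mathbb{C}$. For $\gamma>0$, $\mathcal{H}_\gamma(\mathbb{D})$ is the reproducing kernel Hilbert space of holomorphic functions on $\mathbb{D}$ with reproducing kernel $k_\lambda(z)=(1-\overline{\lambda}z)^{-\gamma}$ for $\lambda,z\in\mathbb{D}$ (principal branch), so $\langle f,k_\lambda\rangle=f(\lambda)$ and $\|k_\lambda\|^2=(1-|\lambda|^2)^{-\gamma}$. Put $\widehat{k}_\lambda=k_\lambda/\|k_\lambda\|$. For a bounded linear operator $T$ on $\mathcal{H}_\gamma(\mathbb{D})$, the Berezin transform is $\widetilde{T}(\lambda)=\langle T\widehat{k}_\lambda,\widehat{k}_\lambda\rangle$ for $\lambda\in\mathbb{D}$, and the Berezin range is $\mathrm{Ber}(T)=\{\widetilde{T}(\lambda):\lambda\in\mathbb{D}\}\subseteq\mathbb{C}$. Here $z^i$ denotes the function $z\mapsto z^i$. *)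

theory Defs
  imports "HOL-Complex_Analysis.Complex_Analysis"
begin

(* Complex Hilbert spaces of functions on a set X, given by their carrier H and
   inner product ip.  Functions on X are represented by total functions that
   vanish outside X, so that equality on X is equality in HOL.
   The inner product is linear in its first argument. *)

definition ip_norm :: "(('a \<Rightarrow> complex) \<Rightarrow> ('a \<Rightarrow> complex) \<Rightarrow> complex) \<Rightarrow> ('a \<Rightarrow> complex) \<Rightarrow> real"
  where "ip_norm ip f = sqrt (Re (ip f f))"

locale hilbert_function_space =
  fixes X :: "'a set"
    and H :: "('a \<Rightarrow> complex) set"
    and ip :: "('a \<Rightarrow> complex) \<Rightarrow> ('a \<Rightarrow> complex) \<Rightarrow> complex"
  assumes vanish_outside: "\<And>f x. f \<in> H \<Longrightarrow> x \<notin> X \<Longrightarrow> f x = 0"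
    and zero_mem: "(\<lambda>x. 0) \<in> H"
    and add_mem: "\<And>f g. f \<in> H \<Longrightarrow> g \<in> H \<Longrightarrow> (\<lambda>x. f x + g x) \<in> H"
    and scale_mem: "\<And>c f. f \<in> H \<Longrightarrow> (\<lambda>x. c * f x) \<in> H"
    and ip_add_left: "\<And>f g h. f \<in> H \<Longrightarrow> g \<in> H \<Longrightarrow> h \<in> H \<Longrightarrow>
          ip (\<lambda>x. f x + g x) h = ip f h + ip g h"
    and ip_scale_left: "\<And>c f h. f \<in> H \<Longrightarrow> h \<in> H \<Longrightarrow> ip (\<lambda>x. c * f x) h = c * ip f h"
    and ip_commute: "\<And>f g. f \<in> H \<Longrightarrow> g \<in> H \<Longrightarrow> ip g f = cnj (ip f g)"
    and ip_nonneg: "\<And>f. f \<in> H \<Longrightarrow> Re (ip f f) \<ge> 0"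
    and ip_definite: "\<And>f. f \<in> H \<Longrightarrow> ip f f = 0 \<Longrightarrow> f = (\<lambda>x. 0)"
    and complete: "\<And>F. (\<And>m :: nat. F m \<in> H) \<Longrightarrow>
          (\<And>e. e > 0 \<Longrightarrow> \<exists>N. \<forall>m\<ge>N. \<forall>k\<ge>N. ip_norm ip (\<lambda>x. F m x - F k x) < e) \<Longrightarrow>
          \<exists>f\<in>H. (\<lambda>m. ip_norm ip (\<lambda>x. F m x - f x)) \<longlonglongrightarrow> 0"

(* K l is the kernel function at the point l. *)
locale reproducing_kernel_hilbert_space = hilbert_function_space X H ip
  for X :: "'a set" and H :: "('a \<Rightarrow> complex) set"
    and ip :: "('a \<Rightarrow> complex) \<Rightarrow> ('a \<Rightarrow> complex) \<Rightarrow> complex" +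
  fixes K :: "'a \<Rightarrow> 'a \<Rightarrow> complex"
  assumes kernel_mem: "\<And>l. l \<in> X \<Longrightarrow> K l \<in> H"
    and reproducing: "\<And>f l. f \<in> H \<Longrightarrow> l \<in> X \<Longrightarrow> ip f (K l) = f l"

definition normalized_kernel ::
    "(('a \<Rightarrow> complex) \<Rightarrow> ('a \<Rightarrow> complex) \<Rightarrow> complex) \<Rightarrow> ('a \<Rightarrow> 'a \<Rightarrow> complex) \<Rightarrow> 'a \<Rightarrow> 'a \<Rightarrow> complex"
  where "normalized_kernel ip K l = (\<lambda>x. K l x / of_real (ip_norm ip (K l)))"

definition berezin_transform ::
    "(('a \<Rightarrow> complex) \<Rightarrow> ('a \<Rightarrow> complex) \<Rightarrow> complex) \<Rightarrow> ('a \<Rightarrow> 'a \<Rightarrow> complex) \<Rightarrow>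
     (('a \<Rightarrow> complex) \<Rightarrow> ('a \<Rightarrow> complex)) \<Rightarrow> 'a \<Rightarrow> complex"
  where "berezin_transform ip K T l = ip (T (normalized_kernel ip K l)) (normalized_kernel ip K l)"

definition berezin_range ::
    "'a set \<Rightarrow> (('a \<Rightarrow> complex) \<Rightarrow> ('a \<Rightarrow> complex) \<Rightarrow> complex) \<Rightarrow> ('a \<Rightarrow> 'a \<Rightarrow> complex) \<Rightarrow>
     (('a \<Rightarrow> complex) \<Rightarrow> ('a \<Rightarrow> complex)) \<Rightarrow> complex set"
  where "berezin_range X ip K T = berezin_transform ip K T ` X"

abbreviation unit_disc :: "complex set"
  where "unit_disc \<equiv> ball 0 1"

(* For l and z in the disc, 1 - cnj l * z has positive real part, so the complex
   powr, which is defined through Ln, is the principal branch. *)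
definition disc_kernel :: "real \<Rightarrow> complex \<Rightarrow> complex \<Rightarrow> complex"
  where "disc_kernel \<gamma> l = (\<lambda>z. if z \<in> unit_disc then (1 - cnj l * z) powr (- of_real \<gamma>) else 0)"

definition disc_monomial :: "nat \<Rightarrow> complex \<Rightarrow> complex"
  where "disc_monomial i = (\<lambda>z. if z \<in> unit_disc then z ^ i else 0)"

(* The space with kernel disc_kernel \<gamma>.  By the uniqueness part of the
   Moore-Aronszajn theorem, \<gamma> determines H, and ip on H.  That the monomials
   lie in H is a consequence of the axioms and is not assumed. *)
locale disc_rkhs =
  reproducing_kernel_hilbert_space unit_disc H ip "disc_kernel \<gamma>"
  for \<gamma> :: real
    and H :: "(complex \<Rightarrow> complex) set"
    and ip :: "(complex \<Rightarrow> complex) \<Rightarrow> (complex \<Rightarrow> complex) \<Rightarrow> complex" +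
  assumes gamma_pos: "\<gamma> > 0"
    and holomorphic: "\<And>f. f \<in> H \<Longrightarrow> f holomorphic_on unit_disc"

definition monomial_operator ::
    "((complex \<Rightarrow> complex) \<Rightarrow> (complex \<Rightarrow> complex) \<Rightarrow> complex) \<Rightarrow> nat \<Rightarrow> (nat \<Rightarrow> complex) \<Rightarrow>
     (complex \<Rightarrow> complex) \<Rightarrow> (complex \<Rightarrow> complex)"
  where "monomial_operator ip n a f =
    (\<lambda>z. \<Sum>i=1..n. ip f (\<lambda>w. a i * disc_monomial i w) * (a i * disc_monomial i z))"

end

theory Submission
  imports Defs
begin

text \<open>
  The axioms of the space only provide the kernel functions, so the point is to show that the
  monomials belong to it.  With the kernel expanded as a power series in \<open>cnj l * z\<close>, the average
  of \<open>w\<^sup>m k\<^sub>l\<close> over \<open>l = w / 2\<close>, with \<open>w\<close> ranging over the \<open>N\<close>-th roots of unity, keeps only the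
  terms whose index is congruent to \<open>m\<close> modulo \<open>N\<close>.  It therefore converges uniformly on the disc
  to a nonzero multiple of \<open>z\<^sup>m\<close> as \<open>N\<close> grows.  By the reproducing property, the inner product
  of \<open>f\<close> with such an average is an average of values of \<open>f\<close>, up to unimodular factors, so it is
  bounded by the supremum of \<open>f\<close>; hence the averages are also Cauchy in the Hilbert space norm,
  and completeness gives the monomial.
  The Berezin transform of the operator is then the continuous real function
  \<open>(1 - \<bar>l\<bar>\<^sup>2)\<^sup>\<gamma> (\<Sum>i. \<bar>a\<^sub>i l\<^sup>i\<bar>\<^sup>2)\<close> of \<open>l\<close>, and its range is a connected set of reals.
\<close>

section \<open>Algebra of the inner product and the Cauchy-Schwarz inequality\<close>

context hilbert_function_space
begin

lemma diff_mem: "f \<in> H \<Longrightarrow> g \<in> H \<Longrightarrow> (\<lambda>x. f x - g x) \<in> H"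
  using add_mem[of f "\<lambda>x. (-1) * g x"] scale_mem[of g "-1"] by simp

lemma sum_mem:
  assumes "finite J" "\<And>j. j \<in> J \<Longrightarrow> f j \<in> H"
  shows "(\<lambda>x. \<Sum>j\<in>J. f j x) \<in> H"
  using assms by (induction J rule: finite_induct) (auto simp: zero_mem add_mem)

lemma ip_diff_left:
  assumes "f \<in> H" "g \<in> H" "h \<in> H"
  shows "ip (\<lambda>x. f x - g x) h = ip f h - ip g h"
  using ip_add_left[of f "\<lambda>x. (-1) * g x" h] ip_scale_left[of g h "-1"] scale_mem[of g "-1"] assms
  by simp

lemma ip_diff_right:
  assumes "f \<in> H" "g \<in> H" "h \<in> H"
  shows "ip h (\<lambda>x. f x - g x) = ip h f - ip h g"
  unfolding ip_commute[OF diff_mem[OF assms(1,2)] assms(3)] ip_commute[OF assms(1,3)]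
    ip_commute[OF assms(2,3)] ip_diff_left[OF assms] by simp

lemma ip_scale_right:
  assumes "f \<in> H" "h \<in> H"
  shows "ip h (\<lambda>x. c * f x) = cnj c * ip h f"
  unfolding ip_commute[OF scale_mem[OF assms(1)] assms(2)] ip_commute[OF assms]
    ip_scale_left[OF assms] by simp

lemma ip_zero_left: "h \<in> H \<Longrightarrow> ip (\<lambda>x. 0) h = 0"
  using ip_scale_left[of "\<lambda>x. 0" h 0] zero_mem by simp

lemma ip_sum_left:
  assumes "finite J" "\<And>j. j \<in> J \<Longrightarrow> f j \<in> H" "h \<in> H"
  shows "ip (\<lambda>x. \<Sum>j\<in>J. f j x) h = (\<Sum>j\<in>J. ip (f j) h)"
  using assms(1,2)
proof (induction J rule: finite_induct)
  case empty
  then show ?case using ip_zero_left assms by simp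
next
  case (insert j J)
  then show ?case
    using ip_add_left[of "f j" "\<lambda>x. \<Sum>j\<in>J. f j x" h] sum_mem[of J f] assms(3) by auto
qed

lemma ip_sum_right:
  assumes "finite J" "\<And>j. j \<in> J \<Longrightarrow> f j \<in> H" "h \<in> H"
  shows "ip h (\<lambda>x. \<Sum>j\<in>J. f j x) = (\<Sum>j\<in>J. ip h (f j))"
proof -
  have "ip h (\<lambda>x. \<Sum>j\<in>J. f j x) = cnj (\<Sum>j\<in>J. ip (f j) h)"
    using ip_sum_left[OF assms] ip_commute[OF sum_mem[OF assms(1,2)] assms(3)] by simp
  also have "\<dots> = (\<Sum>j\<in>J. ip h (f j))"
    by (simp add: ip_commute[OF assms(2,3)])
  finally show ?thesis .
qed

lemma ip_self_eq: "f \<in> H \<Longrightarrow> ip f f = of_real (Re (ip f f))"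
  by (metis ip_commute Reals_cnj_iff of_real_Re)

lemma Cauchy_Schwarz:
  assumes f: "f \<in> H" and g: "g \<in> H"
  shows "(norm (ip f g))\<^sup>2 \<le> Re (ip f f) * Re (ip g g)"
proof (cases "Re (ip g g) = 0")
  case True
  then have "g = (\<lambda>x. 0)"
    using ip_definite[of g] ip_self_eq[of g] g by simp
  then show ?thesis
    using ip_commute[of g f] ip_zero_left[of f] True f g by simp
next
  case False
  define A B C where "A = Re (ip f f)" and "B = Re (ip g g)" and "C = ip f g"
  have B: "B > 0" using False ip_nonneg[OF g] by (simp add: B_def)
  have ff: "ip f f = of_real A" and gg: "ip g g = of_real B" and gf: "ip g f = cnj C"
    unfolding A_def B_def C_def using ip_self_eq f g ip_commute by blast+
  \<comment> \<open>\<open>h\<close> is \<open>B\<close> times the component of \<open>f\<close>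
    orthogonal to \<open>g\<close>. The factor \<open>B\<close> avoids a division, and nonnegativity
    of \<open>ip h h\<close> is the claim multiplied by \<open>B\<close>.\<close>
  define h where "h = (\<lambda>x. of_real B * f x - C * g x)"
  have m: "(\<lambda>x. of_real B * f x) \<in> H" "(\<lambda>x. C * g x) \<in> H" using f g scale_mem by auto
  have "ip h h = of_real B * of_real B * ip f f - of_real B * cnj C * ip f g
      - C * of_real B * ip g f + C * cnj C * ip g g"
    unfolding h_def using m f g
    by (simp add: ip_diff_left ip_diff_right ip_scale_left ip_scale_right diff_mem algebra_simps)
  also have "\<dots> = of_real B * (of_real B * of_real A - C * cnj C)"
    by (simp add: ff gg gf C_def[symmetric] algebra_simps)
  also have "\<dots> = of_real (B * (B * A - (norm C)\<^sup>2))"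
    by (simp add: complex_norm_square[symmetric])
  finally have "Re (ip h h) = B * (B * A - (norm C)\<^sup>2)" by simp
  moreover have "h \<in> H" unfolding h_def using m diff_mem by auto
  ultimately have "0 \<le> B * (B * A - (norm C)\<^sup>2)" using ip_nonneg by metis
  then have "0 \<le> B * A - (norm C)\<^sup>2" using B by (simp add: zero_le_mult_iff)
  then show ?thesis by (simp add: A_def B_def C_def mult.commute)
qed

end

section \<open>Continuity of point evaluations\<close>

context reproducing_kernel_hilbert_space
begin

lemma norm_eval_le:
  assumes "f \<in> H" "x \<in> X"
  shows "norm (f x) \<le> ip_norm ip f * ip_norm ip (K x)"
proof -
  have "(norm (f x))\<^sup>2 \<le> (ip_norm ip f * ip_norm ip (K x))\<^sup>2"
    using Cauchy_Schwarz[of f "K x"] assms kernel_mem ip_nonneg ip_nonneg[of "K x"] reproducing[of f x]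
    by (simp add: ip_norm_def power_mult_distrib)
  then show ?thesis
    by (rule power2_le_imp_le) (use assms kernel_mem ip_nonneg in \<open>simp add: ip_norm_def\<close>)
qed

text \<open>Serves to identify a limit in norm, which completeness provides abstractly, through its
  pointwise values.\<close>

lemma tendsto_eval:
  assumes F: "\<And>k. F k \<in> H" and f: "f \<in> H" and x: "x \<in> X"
    and lim: "(\<lambda>k. ip_norm ip (\<lambda>x. F k x - f x)) \<longlonglongrightarrow> 0"
  shows "(\<lambda>k. F k x) \<longlonglongrightarrow> f x"
proof -
  have "(\<lambda>k. F k x - f x) \<longlonglongrightarrow> 0"
  proof (rule Lim_null_comparison)
    show "\<forall>\<^sub>F k in sequentially. norm (F k x - f x)
        \<le> ip_norm ip (\<lambda>x. F k x - f x) * ip_norm ip (K x)"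
      using norm_eval_le[OF diff_mem[OF F f] x] by simp
    show "(\<lambda>k. ip_norm ip (\<lambda>x. F k x - f x) * ip_norm ip (K x)) \<longlonglongrightarrow> 0"
      using tendsto_mult_right[OF lim] by simp
  qed
  then show ?thesis by (rule LIM_zero_cancel)
qed

end

section \<open>Roots of unity and averages of kernel functions\<close>

lemma sum_roots_of_unity:
  fixes m n N :: nat
  defines "w \<equiv> cis (2 * pi / N)"
  assumes "m < N" "n < N"
  shows "(\<Sum>j<N. w ^ (j * m) * cnj (w ^ j) ^ n) = (if m = n then of_nat N else 0)"
proof -
  \<comment> \<open>The sum is geometric with ratio \<open>q\<close>, an \<open>N\<close>-th root of
    unity. It vanishes unless \<open>q = 1\<close>, which forces m and n to be congruent modulo
    \<open>N\<close>, hence equal, both being below \<open>N\<close>.\<close>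
  define q where "q = w ^ m * cnj w ^ n"
  have N: "N > 0" using assms by simp
  have ww: "w * cnj w = 1" by (simp add: w_def cis_cnj cis_mult)
  have wN: "w ^ N = 1" using N by (simp add: w_def Complex.DeMoivre)
  have cN: "cnj w ^ N = 1" using wN by (metis complex_cnj_one complex_cnj_power)
  have "q ^ N = (w ^ N) ^ m * (cnj w ^ N) ^ n"
    by (simp add: q_def power_mult_distrib mult.commute flip: power_mult)
  then have qN: "q ^ N = 1" by (simp add: wN cN)
  have "(\<Sum>j<N. w ^ (j * m) * cnj (w ^ j) ^ n) = (\<Sum>j<N. q ^ j)"
    by (simp add: q_def power_mult_distrib mult.commute flip: power_mult)
  also have "\<dots> = (if m = n then of_nat N else 0)"
  proof (cases "m = n")
    case True
    then have "q = 1" by (simp add: q_def ww flip: power_mult_distrib)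
    then show ?thesis using True by simp
  next
    case False
    have "q \<noteq> 1"
    proof
      assume "q = 1"
      then have "w ^ m * (cnj w * w) ^ n = w ^ n"
        unfolding q_def power_mult_distrib by (metis mult.assoc mult_1)
      then have "w ^ m = w ^ n" using ww by (simp add: mult.commute)
      then have "exp (2 * of_real pi * \<i> * of_nat m / of_nat N)
          = exp (2 * of_real pi * \<i> * of_nat n / of_nat N)"
        by (simp add: w_def Complex.DeMoivre cis_conv_exp exp_of_nat_mult[symmetric] mult_ac)
      then have "m mod N = n mod N" using N by (subst (asm) complex_root_unity_eq) auto
      with assms False show False by simp
    qed
    then show ?thesis using False qN by (simp add: geometric_sum)
  qed
  finally show ?thesis .
qed

text \<open>The Taylor coefficients of \<open>(1 - x) powr (- \<gamma>)\<close>, that is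
  \<gamma>(\<gamma>+1)...(\<gamma>+k-1)/k!. The sign comes from putting -x into the binomial
  series.\<close>

definition kernel_coeff :: "real \<Rightarrow> nat \<Rightarrow> complex"
  where "kernel_coeff \<gamma> k = ((- of_real \<gamma>) gchoose k) * (-1) ^ k"

text \<open>Every factor of the product for the binomial coefficient has negative real part. This
  later allows division by the coefficient of the monomial.\<close>

lemma kernel_coeff_nonzero:
  assumes "\<gamma> > 0"
  shows "kernel_coeff \<gamma> k \<noteq> 0"
proof -
  have "- complex_of_real \<gamma> - of_nat i \<noteq> 0" for i
  proof -
    have "Re (- complex_of_real \<gamma> - of_nat i) < 0" using assms by simp
    then show ?thesis by (metis less_irrefl zero_complex.sel(1))
  qed
  then show ?thesis
    by (simp add: kernel_coeff_def gbinomial_prod_rev)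
qed

lemma norm_cnj_mult_less_one:
  assumes "l \<in> unit_disc" "z \<in> unit_disc"
  shows "norm (cnj l * z) < 1"
proof -
  have "norm l * norm z \<le> norm l * 1" using assms by (intro mult_left_mono) auto
  then show ?thesis using assms by (simp add: norm_mult)
qed

lemma disc_kernel_sums:
  assumes "l \<in> unit_disc" "z \<in> unit_disc"
  shows "(\<lambda>k. kernel_coeff \<gamma> k * (cnj l * z) ^ k) sums disc_kernel \<gamma> l z"
proof -
  have "norm (- (cnj l * z)) < 1" using norm_cnj_mult_less_one[OF assms] by simp
  from gen_binomial_complex[OF this, of "- of_real \<gamma>"] show ?thesis
    using assms unfolding power_minus[of "cnj l * z"]
    by (simp add: kernel_coeff_def disc_kernel_def mult.assoc)
qed

lemma summable_norm_kernel_coeff: "summable (\<lambda>k. norm (kernel_coeff \<gamma> k) * (1/2) ^ k)"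
proof -
  \<comment> \<open>The product 3/4 * 3/4 = 9/16 exceeds 1/2, so convergence there gives absolute
    convergence at 1/2.\<close>
  have "summable (\<lambda>k. kernel_coeff \<gamma> k * (cnj (3/4) * (3/4)) ^ k)"
    using disc_kernel_sums[of "3/4" "3/4" \<gamma>] by (simp add: sums_iff)
  from powser_insidea[OF this, of "1/2"] show ?thesis
    by (simp add: norm_mult norm_power)
qed

text \<open>The nodes have modulus 1/2, so \<open>cnj l * z\<close> stays in the disc of radius 1/2
  for every z in the unit disc, which makes tail estimates uniform in z. For \<open>N = 0\<close>
  the sum is empty.\<close>

definition kernel_average :: "real \<Rightarrow> nat \<Rightarrow> nat \<Rightarrow> complex \<Rightarrow> complex"
  where "kernel_average \<gamma> m N = (\<lambda>z. \<Sum>j<N.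
    (cis (2 * pi / N) ^ (j * m) / of_nat N) * disc_kernel \<gamma> (cis (2 * pi / N) ^ j / 2) z)"

text \<open>Averaging multiplies the k-th term of the series by a factor \<open>A k\<close>. Below
  \<open>N\<close> it is 1 at m and 0 elsewhere; from \<open>N\<close> on it is at most 1 in
  modulus, so the error is at most a tail of the majorant.\<close>

lemma kernel_average_approx:
  assumes "m < N" "z \<in> unit_disc"
  shows "norm (kernel_average \<gamma> m N z - kernel_coeff \<gamma> m * (z / 2) ^ m)
    \<le> (\<Sum>k. norm (kernel_coeff \<gamma> (k + N)) * (1/2) ^ (k + N))"
proof -
  define w where "w = cis (2 * pi / N)"
  define A where "A k = (\<Sum>j<N. w ^ (j * m) / of_nat N * cnj (w ^ j) ^ k)" for k
  define t where "t k = A k * (kernel_coeff \<gamma> k * (z / 2) ^ k)" for k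
  have w: "norm w = 1" by (simp add: w_def)
  have N: "N > 0" using assms by simp
  have A: "A k = (if m = k then 1 else 0)" if "k < N" for k
    using sum_roots_of_unity[OF assms(1) that] N
    by (simp add: A_def w_def divide_simps flip: sum_divide_distrib)
  have normA: "norm (A k) \<le> 1" for k
  proof -
    have "norm (A k) \<le> (\<Sum>j<N. norm (w ^ (j * m) / of_nat N * cnj (w ^ j) ^ k))"
      unfolding A_def by (rule norm_sum)
    also have "\<dots> = 1" using N by (simp add: norm_mult norm_power norm_divide w)
    finally show ?thesis .
  qed
  have "(\<lambda>k. \<Sum>j<N. w ^ (j * m) / of_nat N * (kernel_coeff \<gamma> k * (cnj (w ^ j / 2) * z) ^ k))
      sums kernel_average \<gamma> m N z"
    unfolding kernel_average_def w_def[symmetric]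
    by (intro sums_sum sums_mult disc_kernel_sums) (use assms w in \<open>auto simp: norm_power norm_divide\<close>)
  also have "(\<lambda>k. \<Sum>j<N. w ^ (j * m) / of_nat N * (kernel_coeff \<gamma> k * (cnj (w ^ j / 2) * z) ^ k)) = t"
    by (simp add: fun_eq_iff t_def A_def sum_distrib_left sum_distrib_right sum_divide_distrib
        power_mult_distrib power_divide mult_ac)
  finally have t: "t sums kernel_average \<gamma> m N z" .
  have "(\<Sum>k<N. t k) = (\<Sum>k<N. if m = k then kernel_coeff \<gamma> k * (z / 2) ^ k else 0)"
    by (intro sum.cong) (auto simp: t_def A)
  also have "\<dots> = kernel_coeff \<gamma> m * (z / 2) ^ m" using assms by simp
  finally have "kernel_average \<gamma> m N z - kernel_coeff \<gamma> m * (z / 2) ^ m = (\<Sum>k. t (k + N))"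
    using suminf_split_initial_segment[of t N] t by (simp add: sums_iff)
  also have "norm \<dots> \<le> (\<Sum>k. norm (kernel_coeff \<gamma> (k + N)) * (1/2) ^ (k + N))"
  proof (rule norm_suminf_le)
    show "norm (t (k + N)) \<le> norm (kernel_coeff \<gamma> (k + N)) * (1/2) ^ (k + N)" for k
    proof -
      have "norm (t (k + N)) = norm (A (k + N)) * (norm (kernel_coeff \<gamma> (k + N)) * (norm z / 2) ^ (k + N))"
        by (simp add: t_def norm_mult norm_power norm_divide)
      also have "\<dots> \<le> 1 * (norm (kernel_coeff \<gamma> (k + N)) * (1 / 2) ^ (k + N))"
        using assms by (intro mult_mono normA power_mono order_refl) auto
      finally show ?thesis by simp
    qed
    show "summable (\<lambda>k. norm (kernel_coeff \<gamma> (k + N)) * (1/2) ^ (k + N))"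
      using summable_ignore_initial_segment[OF summable_norm_kernel_coeff] .
  qed
  finally show ?thesis .
qed

section \<open>Membership of the monomials in the space\<close>

context disc_rkhs
begin

lemma kernel_average_mem: "kernel_average \<gamma> m N \<in> H"
  unfolding kernel_average_def
  by (intro sum_mem scale_mem kernel_mem) (auto simp: norm_power norm_divide)

text \<open>The \<open>N\<close> weights have modulus 1/N each, so the bound does not grow with
  \<open>N\<close>. This turns uniform estimates into norm estimates.\<close>

lemma norm_ip_kernel_average_le:
  assumes f: "f \<in> H" and le: "\<And>z. z \<in> unit_disc \<Longrightarrow> norm (f z) \<le> e" and "N > 0"
  shows "norm (ip f (kernel_average \<gamma> m N)) \<le> e"
proof -
  define w where "w = cis (2 * pi / N)"
  have w: "norm w = 1" by (simp add: w_def)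
  have d: "w ^ j / 2 \<in> unit_disc" for j by (simp add: norm_power norm_divide w)
  have "ip f (kernel_average \<gamma> m N) = (\<Sum>j<N. cnj (w ^ (j * m) / of_nat N) * f (w ^ j / 2))"
    unfolding kernel_average_def w_def[symmetric]
    by (simp only: ip_sum_right finite_lessThan ip_scale_right scale_mem kernel_mem d reproducing f)
  also have "norm \<dots> \<le> (\<Sum>j<N. norm (cnj (w ^ (j * m) / of_nat N) * f (w ^ j / 2)))"
    by (rule norm_sum)
  also have "\<dots> \<le> (\<Sum>j<N. e / N)"
    using le[OF d] by (intro sum_mono) (simp add: norm_mult norm_divide norm_power w divide_right_mono)
  also have "\<dots> = e" using assms by simp
  finally show ?thesis .
qed

lemma disc_monomial_mem: "disc_monomial m \<in> H"
proof -
  define F where "F = kernel_average \<gamma> m"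
  define \<epsilon> where "\<epsilon> N = (\<Sum>k. norm (kernel_coeff \<gamma> (k + N)) * (1/2) ^ (k + N))" for N
  have F: "F N \<in> H" for N by (simp add: F_def kernel_average_mem)
  have \<epsilon>: "\<epsilon> \<longlonglongrightarrow> 0"
    unfolding \<epsilon>_def using suminf_exist_split2[OF summable_norm_kernel_coeff] by simp
  have approx: "norm (F N z - kernel_coeff \<gamma> m * (z / 2) ^ m) \<le> \<epsilon> N"
    if "N > m" "z \<in> unit_disc" for N z
    using kernel_average_approx that by (simp add: F_def \<epsilon>_def)
  have dist: "Re (ip (\<lambda>x. F N x - F M x) (\<lambda>x. F N x - F M x)) \<le> 2 * (\<epsilon> N + \<epsilon> M)"
    if "N > m" "M > m" for N M
  proof -
    define g where "g = (\<lambda>x. F N x - F M x)"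
    have g: "g \<in> H" by (simp add: g_def F diff_mem)
    have bd: "norm (g z) \<le> \<epsilon> N + \<epsilon> M" if "z \<in> unit_disc" for z
      using approx[OF \<open>N > m\<close> that] approx[OF \<open>M > m\<close> that] unfolding g_def by norm
    \<comment> \<open>Only the second argument of \<open>ip g g\<close> is split; each pairing of
      \<open>g\<close> with an average is bounded by the supremum of \<open>g\<close>.\<close>
    have "Re (ip g g) \<le> norm (ip g (F N) - ip g (F M))"
      using ip_diff_right[OF F F g, of N M] complex_Re_le_cmod[of "ip g g"] by (simp add: g_def)
    also have "\<dots> \<le> norm (ip g (F N)) + norm (ip g (F M))" by (rule norm_triangle_ineq4)
    also have "\<dots> \<le> (\<epsilon> N + \<epsilon> M) + (\<epsilon> N + \<epsilon> M)"
      unfolding F_def by (intro add_mono norm_ip_kernel_average_le g bd) (use that in auto)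
    finally show ?thesis by (simp add: g_def)
  qed
  have "\<exists>f\<in>H. (\<lambda>N. ip_norm ip (\<lambda>x. F N x - f x)) \<longlonglongrightarrow> 0"
  proof (rule complete[OF F])
    fix e :: real assume e: "e > 0"
    \<comment> \<open>With both tails below e^2/4, the bound 2(\<epsilon> N + \<epsilon> M) on the
      squared norm is below e^2.\<close>
    then have "\<forall>\<^sub>F N in sequentially. \<epsilon> N < e\<^sup>2 / 4"
      by (intro order_tendstoD(2)[OF \<epsilon>]) auto
    with eventually_gt_at_top[of m] have "\<forall>\<^sub>F N in sequentially. N > m \<and> \<epsilon> N < e\<^sup>2 / 4"
      by (rule eventually_conj)
    then obtain N0 where N0: "\<And>N. N \<ge> N0 \<Longrightarrow> N > m \<and> \<epsilon> N < e\<^sup>2 / 4"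
      unfolding eventually_sequentially by auto
    have "ip_norm ip (\<lambda>x. F N x - F M x) < e" if "N \<ge> N0" "M \<ge> N0" for N M
    proof -
      have "Re (ip (\<lambda>x. F N x - F M x) (\<lambda>x. F N x - F M x)) < e\<^sup>2"
        using dist[of N M] N0[OF that(1)] N0[OF that(2)] by argo
      then show ?thesis unfolding ip_norm_def using e by (intro real_less_lsqrt) auto
    qed
    then show "\<exists>N0. \<forall>N\<ge>N0. \<forall>M\<ge>N0. ip_norm ip (\<lambda>x. F N x - F M x) < e" by blast
  qed
  then obtain f where f: "f \<in> H" and lim: "(\<lambda>N. ip_norm ip (\<lambda>x. F N x - f x)) \<longlonglongrightarrow> 0" by blast
  define c where "c = kernel_coeff \<gamma> m / 2 ^ m"
  have c: "c \<noteq> 0" using kernel_coeff_nonzero[OF gamma_pos] by (simp add: c_def)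
  have fz: "f z = c * z ^ m" if "z \<in> unit_disc" for z
  proof -
    \<comment> \<open>The averages also converge pointwise to the multiple of the monomial, so
      uniqueness of limits determines \<open>f\<close> on the disc.\<close>
    have "(\<lambda>N. F N z - kernel_coeff \<gamma> m * (z / 2) ^ m) \<longlonglongrightarrow> 0"
      by (rule Lim_null_comparison[OF _ \<epsilon>])
        (use approx that in \<open>auto intro: eventually_mono[OF eventually_gt_at_top[of m]]\<close>)
    then have "(\<lambda>N. F N z) \<longlonglongrightarrow> kernel_coeff \<gamma> m * (z / 2) ^ m" by (rule LIM_zero_cancel)
    from LIMSEQ_unique[OF tendsto_eval[OF F f that lim] this] show ?thesis
      by (simp add: c_def power_divide)
  qed
  \<comment> \<open>Outside the disc both sides are 0 by the convention for members of
    \<open>H\<close>.\<close>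
  have "(\<lambda>z. (1 / c) * f z) = disc_monomial m"
    using fz c vanish_outside[OF f] by (auto simp: disc_monomial_def fun_eq_iff)
  then show ?thesis using scale_mem[OF f, of "1 / c"] by simp
qed

lemma disc_kernel_diag:
  assumes "l \<in> unit_disc"
  shows "disc_kernel \<gamma> l l = of_real ((1 - (norm l)\<^sup>2) powr (- \<gamma>))" "(norm l)\<^sup>2 < 1"
proof -
  show 1: "(norm l)\<^sup>2 < 1" using assms by (simp add: power_less_one_iff abs_square_less_1)
  \<comment> \<open>The base is a positive real, so the principal complex power agrees with the real
    one.\<close>
  have "1 - cnj l * l = of_real (1 - (norm l)\<^sup>2)"
    by (simp add: complex_norm_square mult.commute del: of_real_power)
  then show "disc_kernel \<gamma> l l = of_real ((1 - (norm l)\<^sup>2) powr (- \<gamma>))"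
    using powr_of_real[of "1 - (norm l)\<^sup>2" "- \<gamma>"] assms 1 by (simp add: disc_kernel_def)
qed

text \<open>Pairing with the normalized kernel is evaluation at \<open>l\<close> times
  \<open>s\<close>. This occurs once in each coefficient \<open>ip k (b i)\<close>, conjugated, and
  once in the outer inner product, giving \<open>s\<^sup>2\<close> times the squared moduli of
  \<open>b i l\<close>.\<close>

lemma berezin_monomial_operator:
  assumes l: "l \<in> unit_disc"
  shows "berezin_transform ip (disc_kernel \<gamma>) (monomial_operator ip n a) l
    = of_real ((1 - (norm l)\<^sup>2) powr \<gamma> * (\<Sum>i=1..n. (norm (a i * l ^ i))\<^sup>2))"
proof -
  define b where "b i = (\<lambda>w. a i * disc_monomial i w)" for i
  define s where "s = 1 / ip_norm ip (disc_kernel \<gamma> l)"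
  define k where "k = (\<lambda>z. of_real s * disc_kernel \<gamma> l z)"
  have b: "b i \<in> H" and bl: "b i l = a i * l ^ i" for i
    using l scale_mem[OF disc_monomial_mem] by (auto simp: b_def disc_monomial_def)
  have k: "k \<in> H" and k0: "disc_kernel \<gamma> l \<in> H" using l by (auto simp: k_def scale_mem kernel_mem)
  have "Re (ip (disc_kernel \<gamma> l) (disc_kernel \<gamma> l)) = (1 - (norm l)\<^sup>2) powr (- \<gamma>)"
    using reproducing[OF k0 l] disc_kernel_diag[OF l] by simp
  then have s2: "s\<^sup>2 = (1 - (norm l)\<^sup>2) powr \<gamma>"
    by (simp add: s_def ip_norm_def power_divide powr_minus field_simps)
  have ipk: "ip f k = of_real s * f l" if "f \<in> H" for f
    using ip_scale_right[OF k0 that] reproducing[OF that l] by (simp add: k_def)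
  have nk: "normalized_kernel ip (disc_kernel \<gamma>) l = k"
    by (simp add: normalized_kernel_def k_def s_def)
  have T: "monomial_operator ip n a k = (\<lambda>z. \<Sum>i=1..n. ip k (b i) * b i z)"
    by (simp add: monomial_operator_def b_def)
  have "berezin_transform ip (disc_kernel \<gamma>) (monomial_operator ip n a) l
      = of_real s * (\<Sum>i=1..n. ip k (b i) * b i l)"
    unfolding berezin_transform_def nk T by (rule ipk) (auto intro!: sum_mem scale_mem b)
  also have "\<dots> = of_real s * (\<Sum>i=1..n. of_real (s * (norm (b i l))\<^sup>2))"
  proof -
    have "ip k (b i) * b i l = of_real (s * (norm (b i l))\<^sup>2)" for i
      using ip_commute[OF b k, of i] ipk[OF b, of i]
      by (simp add: complex_norm_square mult_ac del: of_real_power)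
    then show ?thesis by simp
  qed
  also have "\<dots> = of_real (s\<^sup>2 * (\<Sum>i=1..n. (norm (b i l))\<^sup>2))"
    by (simp add: sum_distrib_left power2_eq_square mult_ac)
  finally show ?thesis by (simp add: s2 bl)
qed

end

theorem theorem3p3:
  fixes \<gamma> :: real and n :: nat and a :: "nat \<Rightarrow> complex"
    and H :: "(complex \<Rightarrow> complex) set"
    and ip :: "(complex \<Rightarrow> complex) \<Rightarrow> (complex \<Rightarrow> complex) \<Rightarrow> complex"
  assumes "\<gamma> > 0" and "disc_rkhs \<gamma> H ip" and "n \<ge> 1"
  shows "convex (berezin_range unit_disc ip (disc_kernel \<gamma>) (monomial_operator ip n a))"
proof -
  interpret disc_rkhs \<gamma> H ip by fact
  define g :: "complex \<Rightarrow> real"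
    where "g l = (1 - (norm l)\<^sup>2) powr \<gamma> * (\<Sum>i=1..n. (norm (a i * l ^ i))\<^sup>2)" for l
  have range: "berezin_range unit_disc ip (disc_kernel \<gamma>) (monomial_operator ip n a)
      = of_real ` g ` unit_disc"
    unfolding berezin_range_def image_image
    by (intro image_cong refl) (simp only: g_def berezin_monomial_operator)
  \<comment> \<open>The real power is continuous here because its base 1 - |l|^2 is nonzero on the
    disc.\<close>
  have "continuous_on unit_disc g"
    unfolding g_def
    by (intro continuous_intros) (auto dest: disc_kernel_diag(2) simp del: mem_ball)
  then have "connected (g ` unit_disc)"
    by (intro connected_continuous_image convex_connected convex_ball)
  \<comment> \<open>Connected sets of reals are intervals; the real-linear embedding into the
    complex plane preserves convexity.\<close>
  then have "convex (g ` unit_disc)" by (simp add: connected_convex_1)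
  then show ?thesis
    unfolding range by (rule convex_linear_image[OF linear_of_real])
qed

end
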